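(* Let $\mathcal{A}$ be a nonempty real central arrangement of hyperplanes in $\mathbb{R}^\ell$, and let $\mathcal{A} = \mathcal{A}_1 \uplus \mathcal{A}_2 \uplus \cdots \uplus \mathcal{A}_r$ be its decomposition into nonempty indecomposable arrangements. Then for each positive integer $m$ there is a natural bijection \[ AM(\mathcal{A}, m) \simeq AM(\mathcal{A}_1, m) \times AM(\mathcal{A}_2, m) \times \cdots \times AM(\mathcal{A}_r, m). \]
   Context: A real central arrangement $\mathcal{A}=\{H_1,\dots,H_n\}$ in $\mathbb{R}^\ell$ is a finite set of linear hyperplanes; for each $H_j$ fix a real linear form $\alpha_j$ with $H_j=\ker\alpha_j$, and set $H_j^+=\{x:\alpha_j(x)>0\}$, $H_j^-=\{x:\alpha_j(x)<0\}$. The chambers of $\mathcal{A}$ are the connected components of $\mathbb{R}^\ell\setminus\bigcup_j H_j$; $\mathbf{Ch}=\mathbf{Ch}(\mathcal{A})$ is the set of chambers. Let $B=\{+,-\}$, regarded as a multiplicative group of order two. For $\sigma\in B$ and $1\le j\le n$, define $\epsilon_j^\sigma:\mathbf{Ch}\to B$ by $\epsilon_j^\sigma(C)=\sigma\tau$ if $C\subseteq H_j^\tau$, and extend componentwise to $\epsilon_j^\sigma:\mathbf{Ch}^m\to B^m$. A map $\Phi:\mathbf{Ch}^m\to\mathbf{Ch}$ is admissible if there exist maps $\varphi_j^\sigma:B^m\to B$ ($1\le j\le n$, $\sigma\in B$) with (1) $\varphi_j^\sigma(+,\dots,+)=+$ and (2) $\epsilon_j^\sigma\circ\Phi=\varphi_j^\sigma\circ\epsilon_j^\sigma$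 on $\mathbf{Ch}^m$ for all $j,\sigma$. $AM(\mathcal{A},m)$ is the set of admissible maps. Let $r(\mathcal{A})=\operatorname{codim}_{\mathbb{R}^\ell}\bigcap_{H\in\mathcal{A}}H$. $\mathcal{A}$ is decomposable if $\mathcal{A}=\mathcal{A}_1\cup\mathcal{A}_2$ (disjoint) with $\mathcal{A}_1,\mathcal{A}_2$ nonempty and $r(\mathcal{A})=r(\mathcal{A}_1)+r(\mathcal{A}_2)$; one writes $\mathcal{A}=\mathcal{A}_1\uplus\mathcal{A}_2$ (and iterates this notation). $\mathcal{A}$ is indecomposable if it is not decomposable. Every nonempty real central arrangement has a decomposition, unique up to order, into nonempty indecomposable subarrangements (each regarded as an arrangement in $\mathbb{R}^\ell$). *)

theory Defs
  imports "HOL-Analysis.Analysis"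
begin

datatype sign = Pos | Neg

instantiation sign :: comm_monoid_mult
begin

definition one_sign :: sign where
  "1 = Pos"

definition times_sign :: "sign \<Rightarrow> sign \<Rightarrow> sign" where
  "s * t = (if s = t then Pos else Neg)"

instance
proof
  fix a b c :: sign
  show "a * b * c = a * (b * c)"
    by (cases a; cases b; cases c) (simp_all add: times_sign_def)
  show "a * b = b * a"
    by (simp add: times_sign_def)
  show "1 * a = a"
    by (cases a) (simp_all add: times_sign_def one_sign_def)
qed

end

definition codim :: "(real ^ 'n) set \<Rightarrow> nat" where
  "codim S = CARD('n) - dim S"

definition central_arrangement :: "(real ^ 'n) set set \<Rightarrow> bool" where
  "central_arrangement A \<longleftrightarrow> finite A \<and> (\<forall>H\<in>A. subspace H \<and> codim H = 1)"

text \<open>Hyperplanes are not numbered: each \<open>H \<in> A\<close> serves as its own index, and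
  \<open>\<alpha> H\<close> is the form chosen for it.\<close>

definition defining_forms ::
    "((real ^ 'n) set \<Rightarrow> real ^ 'n \<Rightarrow> real) \<Rightarrow> (real ^ 'n) set set \<Rightarrow> bool" where
  "defining_forms \<alpha> A \<longleftrightarrow> (\<forall>H\<in>A. linear (\<alpha> H) \<and> H = {x. \<alpha> H x = 0})"

fun half_space :: "('v \<Rightarrow> real) \<Rightarrow> sign \<Rightarrow> 'v set" where
  "half_space f Pos = {x. f x > 0}"
| "half_space f Neg = {x. f x < 0}"

definition chambers :: "(real ^ 'n) set set \<Rightarrow> (real ^ 'n) set set" where
  "chambers A = components (UNIV - \<Union>A)"

text \<open>The \<open>m\<close>-tuples over \<open>X\<close> are the extensional functions on \<open>{..<m}\<close>.\<close>

abbreviation tuples :: "nat \<Rightarrow> 'a set \<Rightarrow> (nat \<Rightarrow> 'a) set" where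
  "tuples m X \<equiv> {..<m} \<rightarrow>\<^sub>E X"

definition map_tuple :: "nat \<Rightarrow> ('a \<Rightarrow> 'b) \<Rightarrow> (nat \<Rightarrow> 'a) \<Rightarrow> nat \<Rightarrow> 'b" where
  "map_tuple m f c = (\<lambda>k\<in>{..<m}. f (c k))"

text \<open>If \<open>C\<close> is a chamber of an arrangement containing \<open>H\<close>, exactly one of the two open half
  spaces of \<open>H\<close> contains \<open>C\<close>.\<close>

definition eps :: "((real ^ 'n) set \<Rightarrow> real ^ 'n \<Rightarrow> real) \<Rightarrow> (real ^ 'n) set \<Rightarrow> sign
    \<Rightarrow> (real ^ 'n) set \<Rightarrow> sign" where
  "eps \<alpha> H \<sigma> C = \<sigma> * (THE \<tau>. C \<subseteq> half_space (\<alpha> H) \<tau>)"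

text \<open>Admissible maps are extensional on \<open>tuples m (chambers A)\<close>, so that they correspond
  exactly to the maps with that domain. The maps \<open>\<phi> H \<sigma>\<close> matter only on \<open>tuples m UNIV\<close>.\<close>

definition admissible_maps :: "((real ^ 'n) set \<Rightarrow> real ^ 'n \<Rightarrow> real) \<Rightarrow> (real ^ 'n) set set
    \<Rightarrow> nat \<Rightarrow> ((nat \<Rightarrow> (real ^ 'n) set) \<Rightarrow> (real ^ 'n) set) set" where
  "admissible_maps \<alpha> A m =
    {\<Phi> \<in> tuples m (chambers A) \<rightarrow>\<^sub>E chambers A.
      \<exists>\<phi> :: (real ^ 'n) set \<Rightarrow> sign \<Rightarrow> (nat \<Rightarrow> sign) \<Rightarrow> sign.
        \<forall>H\<in>A. \<forall>\<sigma>.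
          \<phi> H \<sigma> (\<lambda>k\<in>{..<m}. Pos) = Pos \<and>
          (\<forall>C\<in>tuples m (chambers A).
            eps \<alpha> H \<sigma> (\<Phi> C) = \<phi> H \<sigma> (map_tuple m (eps \<alpha> H \<sigma>) C))}"

definition arr_rank :: "(real ^ 'n) set set \<Rightarrow> nat" where
  "arr_rank A = codim (\<Inter>A)"

definition is_uplus ::
    "(real ^ 'n) set set \<Rightarrow> (real ^ 'n) set set \<Rightarrow> (real ^ 'n) set set \<Rightarrow> bool" where
  "is_uplus A A1 A2 \<longleftrightarrow> A = A1 \<union> A2 \<and> A1 \<inter> A2 = {} \<and> A1 \<noteq> {} \<and> A2 \<noteq> {} \<and>
     arr_rank A = arr_rank A1 + arr_rank A2"

definition decomposable :: "(real ^ 'n) set set \<Rightarrow> bool" where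
  "decomposable A \<longleftrightarrow> (\<exists>A1 A2. is_uplus A A1 A2)"

text \<open>The iterated decomposition \<open>A = As 0 \<uplus> \<dots> \<uplus> As (r - 1)\<close>, bracketed to the left, into
  nonempty indecomposable parts.\<close>

definition indecomposable_decomposition ::
    "(real ^ 'n) set set \<Rightarrow> nat \<Rightarrow> (nat \<Rightarrow> (real ^ 'n) set set) \<Rightarrow> bool" where
  "indecomposable_decomposition A r As \<longleftrightarrow>
     A = (\<Union>i<r. As i) \<and>
     (\<forall>k. 0 < k \<and> k < r \<longrightarrow> is_uplus (\<Union>i\<le>k. As i) (\<Union>i<k. As i) (As k)) \<and>
     (\<forall>i<r. As i \<noteq> {} \<and> \<not> decomposable (As i))"

text \<open>For a subarrangement \<open>A'\<close> of \<open>A\<close>, this is the projection from the chambers of \<open>A\<close> to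
  those of \<open>A'\<close>: every chamber of \<open>A\<close> lies in a unique chamber of \<open>A'\<close>.\<close>

definition chamber_proj :: "(real ^ 'n) set set \<Rightarrow> (real ^ 'n) set \<Rightarrow> (real ^ 'n) set" where
  "chamber_proj A' C = (THE D. D \<in> chambers A' \<and> C \<subseteq> D)"

text \<open>Naturality of a correspondence \<open>F\<close> between admissible maps of \<open>A\<close> and tuples of admissible
  maps of the parts: each component of \<open>F \<Phi>\<close> is the map induced by \<open>\<Phi>\<close> through the projections.
  As the projections are surjective, this condition determines \<open>F \<Phi> i\<close>.\<close>

definition compatible_with_projections ::
    "((real ^ 'n) set \<Rightarrow> real ^ 'n \<Rightarrow> real) \<Rightarrow> (real ^ 'n) set set \<Rightarrow> nat
     \<Rightarrow> (nat \<Rightarrow> (real ^ 'n) set set) \<Rightarrow> nat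
     \<Rightarrow> (((nat \<Rightarrow> (real ^ 'n) set) \<Rightarrow> (real ^ 'n) set)
         \<Rightarrow> nat \<Rightarrow> (nat \<Rightarrow> (real ^ 'n) set) \<Rightarrow> (real ^ 'n) set) \<Rightarrow> bool" where
  "compatible_with_projections \<alpha> A r As m F \<longleftrightarrow>
     (\<forall>\<Phi>\<in>admissible_maps \<alpha> A m. \<forall>i<r. \<forall>C\<in>tuples m (chambers A).
        chamber_proj (As i) (\<Phi> C) = F \<Phi> i (map_tuple m (chamber_proj (As i)) C))"

end

(* A chamber is determined by its vector of signs, and the admissibility condition at H involves
   only the signs at H.  Hence an admissible map of A descends along the projection to the chambers
   of any subarrangement, with the same functions phi.  Conversely, additivity of the ranks says
   that the common kernels of the parts are in general position (their sums are the whole space), so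
   any choice of one chamber for each part is realised by a chamber of A; thus admissible maps of
   the parts glue. *)
theory Submission
  imports Defs
begin

section \<open>Chambers and sign vectors\<close>

text \<open>The value at 0 is a convention only: signs are compared at points where the form does
  not vanish.\<close>

definition real_sign :: "real \<Rightarrow> sign" where
  "real_sign t = (if t > 0 then Pos else Neg)"

lemma mem_half_space_iff: "f x \<noteq> 0 \<Longrightarrow> x \<in> half_space f \<tau> \<longleftrightarrow> real_sign (f x) = \<tau>"
  by (cases \<tau>) (auto simp: real_sign_def)

lemma defining_forms_subset: "defining_forms \<alpha> A \<Longrightarrow> B \<subseteq> A \<Longrightarrow> defining_forms \<alpha> B"
  by (auto simp: defining_forms_def)

lemma notin_arrangement_iff:
  assumes "defining_forms \<alpha> A"
  shows "x \<notin> \<Union>A \<longleftrightarrow> (\<forall>H\<in>A. \<alpha> H x \<noteq> 0)"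
  using assms unfolding defining_forms_def by blast

lemma chamber_notin_arrangement: "C \<in> chambers A \<Longrightarrow> x \<in> C \<Longrightarrow> x \<notin> \<Union>A"
  unfolding chambers_def using in_components_subset by blast

lemma chamber_nonempty: "C \<in> chambers A \<Longrightarrow> C \<noteq> {}"
  unfolding chambers_def by (rule in_components_nonempty)

lemma chamber_form_nonzero:
  assumes "defining_forms \<alpha> A" "C \<in> chambers A" "H \<in> A" "x \<in> C"
  shows "\<alpha> H x \<noteq> 0"
  using notin_arrangement_iff[OF assms(1), of x] chamber_notin_arrangement[OF assms(2,4)] assms(3)
  by simp

text \<open>Intermediate value argument: the image of \<open>S\<close> is an interval, and two
  different signs would force it to contain 0.\<close>

lemma connected_real_sign_constant:
  fixes f :: "'a::topological_space \<Rightarrow> real"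
  assumes "connected S" "continuous_on S f" "\<forall>z\<in>S. f z \<noteq> 0" "x \<in> S" "y \<in> S"
  shows "real_sign (f x) = real_sign (f y)"
proof (rule ccontr)
  assume *: "real_sign (f x) \<noteq> real_sign (f y)"
  have "connected (f ` S)"
    using assms by (intro connected_continuous_image)
  moreover have "f x \<in> f ` S" "f y \<in> f ` S"
    using assms by auto
  moreover have "(f x \<le> 0 \<and> 0 \<le> f y) \<or> (f y \<le> 0 \<and> 0 \<le> f x)"
    using * by (auto simp: real_sign_def split: if_splits)
  ultimately have "0 \<in> f ` S"
    unfolding connected_iff_interval by blast
  then show False
    using assms(3) by auto
qed

lemma chamber_real_sign_constant:
  fixes A :: "(real ^ 'n) set set"
  assumes "defining_forms \<alpha> A" "C \<in> chambers A" "H \<in> A" "x \<in> C" "y \<in> C"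
  shows "real_sign (\<alpha> H x) = real_sign (\<alpha> H y)"
proof (rule connected_real_sign_constant[where S = C and f = "\<alpha> H"])
  show "connected C"
    using assms unfolding chambers_def by (intro in_components_connected)
  have "linear (\<alpha> H)"
    using assms by (auto simp: defining_forms_def)
  then show "continuous_on C (\<alpha> H)"
    by (simp add: linear_conv_bounded_linear linear_continuous_on)
  show "\<forall>z\<in>C. \<alpha> H z \<noteq> 0"
    using chamber_form_nonzero[OF assms(1-3)] by blast
qed (use assms in auto)

text \<open>A half space is the preimage of an open ray under a linear map, and such preimages of
  convex sets are convex.\<close>

lemma convex_half_space: "linear f \<Longrightarrow> convex (half_space f \<tau>)"
proof -
  assume "linear f"
  have "half_space f \<tau> = f -` (case \<tau> of Pos \<Rightarrow> {0<..} | Neg \<Rightarrow> {..<0})"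
    by (cases \<tau>) auto
  then show ?thesis
    using convex_linear_vimage[OF \<open>linear f\<close>] by (simp split: sign.split)
qed

text \<open>The half spaces of the arrangement that contain \<open>x\<close> intersect in a convex
  set \<open>?S\<close>. It contains \<open>y\<close> because the signs agree, and it misses every
  hyperplane because a form cannot vanish on its own open half space. So \<open>?S\<close> is a
  connected set joining the two points.\<close>

lemma same_signs_imp_connected:
  fixes A :: "(real ^ 'n) set set"
  assumes "defining_forms \<alpha> A" "x \<notin> \<Union>A" "y \<notin> \<Union>A"
    and "\<forall>H\<in>A. real_sign (\<alpha> H x) = real_sign (\<alpha> H y)"
  shows "connected_component (UNIV - \<Union>A) x y"
proof -
  let ?S = "\<Inter>H\<in>A. half_space (\<alpha> H) (real_sign (\<alpha> H x))"
  have nz: "\<forall>H\<in>A. \<alpha> H x \<noteq> 0 \<and> \<alpha> H y \<noteq> 0"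
    using assms(2,3) by (simp add: notin_arrangement_iff[OF assms(1)] del: Union_iff)
  have "convex ?S"
    using assms(1) by (intro convex_INT convex_half_space) (auto simp: defining_forms_def)
  then have "connected ?S"
    by (rule convex_connected)
  moreover have "?S \<subseteq> UNIV - \<Union>A"
  proof
    fix z assume z: "z \<in> ?S"
    have "\<alpha> H z \<noteq> 0" if "z \<in> half_space (\<alpha> H) \<tau>" for H \<tau>
      using that by (cases \<tau>) auto
    then have "z \<notin> \<Union>A"
      using z by (subst notin_arrangement_iff[OF assms(1)]) (meson INT_E)
    then show "z \<in> UNIV - \<Union>A"
      by simp
  qed
  moreover have "x \<in> ?S" "y \<in> ?S"
    using nz assms(4) by (auto simp: mem_half_space_iff)
  ultimately show ?thesis
    unfolding connected_component_def by blast
qed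

text \<open>This resolves the definite description in \<open>eps\<close>: all points of a chamber
  have the same sign at \<open>H\<close>, so any one of them can be used to compute it.\<close>

lemma eps_chamber:
  fixes A :: "(real ^ 'n) set set"
  assumes "defining_forms \<alpha> A" "C \<in> chambers A" "H \<in> A" "x \<in> C"
  shows "eps \<alpha> H \<sigma> C = \<sigma> * real_sign (\<alpha> H x)"
proof -
  have half: "y \<in> half_space (\<alpha> H) \<tau> \<longleftrightarrow> real_sign (\<alpha> H y) = \<tau>" if "y \<in> C" for y \<tau>
    by (rule mem_half_space_iff) (rule chamber_form_nonzero[OF assms(1-3) that])
  have "(THE \<tau>. C \<subseteq> half_space (\<alpha> H) \<tau>) = real_sign (\<alpha> H x)"
  proof (rule the_equality)
    show "C \<subseteq> half_space (\<alpha> H) (real_sign (\<alpha> H x))"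
      using chamber_real_sign_constant[OF assms(1-3) _ assms(4)] half by blast
    show "\<tau> = real_sign (\<alpha> H x)" if "C \<subseteq> half_space (\<alpha> H) \<tau>" for \<tau>
      using half[OF assms(4), of \<tau>] that assms(4) by auto
  qed
  then show ?thesis
    by (simp add: eps_def)
qed

text \<open>With \<sigma> = 1 the value of \<open>eps\<close> is the sign itself, so points of the
  two chambers have equal sign vectors and lie in one component. Every later equality of chambers
  that compares signs goes through this rule.\<close>

lemma chamber_eqI:
  fixes A :: "(real ^ 'n) set set"
  assumes "defining_forms \<alpha> A" "C \<in> chambers A" "D \<in> chambers A"
    and eq: "\<And>H. H \<in> A \<Longrightarrow> eps \<alpha> H 1 C = eps \<alpha> H 1 D"
  shows "C = D"
proof -
  obtain x y where xy: "x \<in> C" "y \<in> D"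
    using chamber_nonempty[OF assms(2)] chamber_nonempty[OF assms(3)] by blast
  have "\<forall>H\<in>A. real_sign (\<alpha> H x) = real_sign (\<alpha> H y)"
    using eq eps_chamber[OF assms(1,2) _ xy(1)] eps_chamber[OF assms(1,3) _ xy(2)] by simp
  then have "connected_component (UNIV - \<Union>A) x y"
    using assms xy by (intro same_signs_imp_connected chamber_notin_arrangement)
  moreover have "C = connected_component_set (UNIV - \<Union>A) x"
    "D = connected_component_set (UNIV - \<Union>A) y"
    using assms(2,3) xy unfolding chambers_def
    by (metis components_iff connected_component_eq)+
  ultimately show ?thesis
    by (simp add: connected_component_eq_eq connected_component_eq)
qed

section \<open>Projection to a subarrangement\<close>

lemma ex_chamber: "x \<notin> \<Union>A \<Longrightarrow> \<exists>C\<in>chambers A. x \<in> C"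
  unfolding chambers_def using Union_components[of "UNIV - \<Union>A"] by blast

lemma subset_chamber:
  assumes "D \<in> chambers A" "connected S" "S \<inter> \<Union>A = {}" "x \<in> S" "x \<in> D"
  shows "S \<subseteq> D"
  using assms components_maximal[of D "UNIV - \<Union>A" S] unfolding chambers_def by blast

lemma chambers_eq_if_common:
  "C \<in> chambers A \<Longrightarrow> D \<in> chambers A \<Longrightarrow> x \<in> C \<Longrightarrow> x \<in> D \<Longrightarrow> C = D"
  using components_nonoverlap[of C "UNIV - \<Union>A" D] unfolding chambers_def by blast

text \<open>This justifies the definite description in \<open>chamber_proj\<close>: \<open>C\<close>
  is connected and avoids the hyperplanes of \<open>B\<close>, so it lies inside the one component
  of the complement of \<open>B\<close> that it meets.\<close>

lemma chamber_proj:
  fixes A :: "(real ^ 'n) set set"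
  assumes "B \<subseteq> A" "C \<in> chambers A"
  shows "chamber_proj B C \<in> chambers B" "C \<subseteq> chamber_proj B C"
proof -
  obtain x where x: "x \<in> C"
    using chamber_nonempty[OF assms(2)] by blast
  have disj: "C \<inter> \<Union>B = {}"
    using chamber_notin_arrangement[OF assms(2)] assms(1) by blast
  then obtain D where D: "D \<in> chambers B" "x \<in> D"
    using x ex_chamber[of x B] by blast
  have "connected C"
    using assms(2) unfolding chambers_def by (rule in_components_connected)
  then have "C \<subseteq> D"
    by (rule subset_chamber[OF D(1) _ disj x D(2)])
  have "chamber_proj B C = D"
    unfolding chamber_proj_def
  proof (rule the_equality)
    show "D' = D" if "D' \<in> chambers B \<and> C \<subseteq> D'" for D'
      using chambers_eq_if_common[of D' B D x] D that x by blast
  qed (use D \<open>C \<subseteq> D\<close> in simp)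
  then show "chamber_proj B C \<in> chambers B" "C \<subseteq> chamber_proj B C"
    using D \<open>C \<subseteq> D\<close> by auto
qed

text \<open>Distinct chambers are disjoint, so a single common point identifies the
  projection.\<close>

lemma chamber_projI:
  fixes A :: "(real ^ 'n) set set"
  assumes "B \<subseteq> A" "C \<in> chambers A" "D \<in> chambers B" "x \<in> C" "x \<in> D"
  shows "chamber_proj B C = D"
  using chambers_eq_if_common[OF chamber_proj(1)[OF assms(1,2)] assms(3) _ assms(5)]
    chamber_proj(2)[OF assms(1,2)] assms(4) by blast

text \<open>Since \<open>C\<close> lies inside its projection, one point of \<open>C\<close>
  computes both signs.\<close>

lemma eps_chamber_proj:
  fixes A :: "(real ^ 'n) set set"
  assumes "defining_forms \<alpha> A" "B \<subseteq> A" "C \<in> chambers A" "H \<in> B"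
  shows "eps \<alpha> H \<sigma> (chamber_proj B C) = eps \<alpha> H \<sigma> C"
proof -
  obtain x where "x \<in> C"
    using chamber_nonempty[OF assms(3)] by blast
  then show ?thesis
    using chamber_proj[OF assms(2,3)] assms(2,4) eps_chamber[OF assms(1,3)]
      eps_chamber[OF defining_forms_subset[OF assms(1,2)] chamber_proj(1)[OF assms(2,3)] assms(4)]
    by (metis subsetD)
qed

lemma hyperplane_negligible:
  fixes H :: "(real ^ 'n) set"
  assumes "codim H = 1"
  shows "negligible H"
  using assms by (intro negligible_lowdim) (auto simp: codim_def)

text \<open>A measure argument: \<open>D\<close> is open and nonempty, hence not negligible, whereas
  finitely many hyperplanes have a negligible union. Thus \<open>D\<close> has a point off all of
  \<open>A\<close>, and the chamber of \<open>A\<close> through that point projects to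
  \<open>D\<close>.\<close>

lemma chamber_proj_surj:
  fixes A :: "(real ^ 'n) set set"
  assumes "central_arrangement A" "B \<subseteq> A" "D \<in> chambers B"
  shows "\<exists>C\<in>chambers A. chamber_proj B C = D"
proof -
  have fin: "finite A" and hyp: "\<And>H. H \<in> A \<Longrightarrow> subspace H \<and> codim H = 1"
    using assms(1) by (auto simp: central_arrangement_def)
  have "closed (\<Union>B)"
  proof (rule closed_Union)
    show "finite B"
      by (rule finite_subset[OF assms(2) fin])
    show "\<forall>H\<in>B. closed H"
    proof
      fix H assume "H \<in> B"
      then have "subspace H"
        using hyp assms(2) by auto
      then show "closed H"
        by (rule closed_subspace)
    qed
  qed
  then have "open (UNIV - \<Union>B)"
    by (rule open_Diff[OF open_UNIV])
  then have "open D"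
    by (rule open_components) (use assms(3) in \<open>simp add: chambers_def\<close>)
  then have "\<not> negligible D"
    using open_not_negligible chamber_nonempty[OF assms(3)] by blast
  moreover have "negligible (\<Union>A)"
    using fin hyp by (simp add: negligible_Union hyperplane_negligible)
  ultimately obtain x where x: "x \<in> D" "x \<notin> \<Union>A"
    using negligible_subset by blast
  then show ?thesis
    using ex_chamber[OF x(2)] chamber_projI[OF assms(2) _ assms(3) _ x(1)] by blast
qed

section \<open>Gluing chambers of the parts\<close>

text \<open>For the common kernels \<open>?V\<close> and \<open>?W\<close>, additivity of rank says
  that the codimension of the intersection is the sum of the codimensions. The dimension formula for
  sums then gives \<open>?V\<close> + \<open>?W\<close> full dimension.\<close>

lemma uplus_sum_eq_UNIV:
  fixes A :: "(real ^ 'n) set set"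
  assumes "is_uplus A B C" "\<And>H. H \<in> A \<Longrightarrow> subspace H"
  shows "\<exists>b\<in>\<Inter>B. \<exists>c\<in>\<Inter>C. x = b + c"
proof -
  let ?V = "\<Inter>B" and ?W = "\<Inter>C"
  let ?S = "{v + w |v w. v \<in> ?V \<and> w \<in> ?W}"
  have A: "A = B \<union> C" and rank: "arr_rank A = arr_rank B + arr_rank C"
    using assms(1) by (auto simp: is_uplus_def)
  have sub: "subspace ?V" "subspace ?W"
    using assms(2) A by (auto intro!: subspace_Inter)
  \<comment> \<open>\<open>codim\<close> is a truncated difference of natural numbers; these bounds
    let linear arithmetic treat it as a true difference.\<close>
  have le: "dim S \<le> CARD('n)" for S :: "(real ^ 'n) set"
    using dim_subset_UNIV[of S] by simp
  have "CARD('n) - dim (?V \<inter> ?W) = (CARD('n) - dim ?V) + (CARD('n) - dim ?W)"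
    using rank by (simp add: arr_rank_def codim_def A Inter_Un_distrib)
  moreover have "dim ?S + dim (?V \<inter> ?W) = dim ?V + dim ?W"
    by (rule dim_sums_Int[OF sub])
  ultimately have "dim ?S = CARD('n)"
    using le[of ?V] le[of ?W] le[of "?V \<inter> ?W"] le[of ?S] by linarith
  then have "span ?S = UNIV"
    by (simp flip: dim_eq_full)
  then have "?S = UNIV"
    using subspace_sums[OF sub] by (simp add: span_eq_iff[THEN iffD2])
  then show ?thesis
    by blast
qed

lemma indecomposable_decomposition_subset:
  "indecomposable_decomposition A r As \<Longrightarrow> i < r \<Longrightarrow> As i \<subseteq> A"
  by (auto simp: indecomposable_decomposition_def)

text \<open>A linear analogue of the Chinese remainder theorem: points \<open>y i\<close> are
  prescribed modulo the common kernels of the parts. The induction on \<open>k\<close> follows the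
  left bracketing of the decomposition and corrects the point found so far for one further part at a
  time.\<close>

lemma ex_point_agreeing:
  fixes A :: "(real ^ 'n) set set"
  assumes "central_arrangement A" "indecomposable_decomposition A r As" "k \<le> r"
  shows "\<exists>x. \<forall>i<k. \<forall>H\<in>As i. x - y i \<in> H"
  using assms(3)
proof (induction k)
  case (Suc k)
  then obtain x where x: "\<forall>i<k. \<forall>H\<in>As i. x - y i \<in> H"
    by auto
  show ?case
  \<comment> \<open>The decomposition provides \<open>is_uplus\<close> only for positive
    \<open>k\<close>; for the first part alone, \<open>y 0\<close> itself is a solution.\<close>
  proof (cases "k = 0")
    case True
    have "0 \<in> H" if "H \<in> As 0" for H
      using that assms indecomposable_decomposition_subset[OF assms(2), of 0] True Suc.prems
      by (auto simp: central_arrangement_def subspace_0)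
    then show ?thesis
      using True by (intro exI[of _ "y 0"]) auto
  next
    case False
    have sub: "subspace H" if "i < r" "H \<in> As i" for H i
      using that assms indecomposable_decomposition_subset[OF assms(2)]
      by (auto simp: central_arrangement_def)
    have "is_uplus (\<Union>i\<le>k. As i) (\<Union>i<k. As i) (As k)"
      using assms(2) False Suc.prems by (auto simp: indecomposable_decomposition_def)
    moreover have "subspace H" if "H \<in> (\<Union>i\<le>k. As i)" for H
    proof -
      from that obtain i where "i \<le> k" "H \<in> As i"
        by blast
      then show ?thesis
        using sub[of i H] Suc.prems by simp
    qed
    \<comment> \<open>The error at the new part is split as \<open>b + c\<close>. Moving
      \<open>x\<close> by \<open>b\<close> preserves agreement with the earlier parts and leaves the
      difference \<open>- c\<close>, which lies in every hyperplane of \<open>As k\<close>.\<close>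
    ultimately have "\<exists>b\<in>\<Inter>(\<Union>i<k. As i). \<exists>c\<in>\<Inter>(As k). y k - x = b + c"
      by (rule uplus_sum_eq_UNIV)
    then obtain b c where bc: "b \<in> \<Inter>(\<Union>i<k. As i)" "c \<in> \<Inter>(As k)" "y k - x = b + c"
      by (elim bexE)
    have "x + b - y i \<in> H" if "i < k" "H \<in> As i" for i H
    proof -
      have "x - y i \<in> H" "b \<in> H"
        using x bc that by auto
      then show ?thesis
        using subspace_add[OF sub, of i H "x - y i" b] that Suc.prems
        by (simp add: algebra_simps)
    qed
    moreover have "x + b - y k \<in> H" if "H \<in> As k" for H
    proof -
      have "x + b - y k = - c"
        using bc(3) by (simp add: algebra_simps)
      then show ?thesis
        using subspace_neg[OF sub, of k H c] bc(2) that Suc.prems by auto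
    qed
    ultimately show ?thesis
      by (intro exI[of _ "x + b"]) (auto simp: less_Suc_eq)
  qed
qed simp

text \<open>Choose a point \<open>y i\<close> in each \<open>D i\<close> and a point
  \<open>x\<close> agreeing with all of them. Then \<open>x\<close> lies off every hyperplane and
  has the signs of \<open>y i\<close> on the part \<open>As i\<close>, so its chamber projects to
  each \<open>D i\<close>.\<close>

lemma ex_chamber_gluing:
  fixes A :: "(real ^ 'n) set set"
  assumes "central_arrangement A" "defining_forms \<alpha> A" "indecomposable_decomposition A r As"
    and D: "\<And>i. i < r \<Longrightarrow> D i \<in> chambers (As i)"
  shows "\<exists>C\<in>chambers A. \<forall>i<r. chamber_proj (As i) C = D i"
proof -
  note sub = indecomposable_decomposition_subset[OF assms(3)]
  have "\<forall>i. \<exists>y. i < r \<longrightarrow> y \<in> D i"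
    using D chamber_nonempty by blast
  then obtain y where y: "\<And>i. i < r \<Longrightarrow> y i \<in> D i"
    by metis
  obtain x where x: "\<forall>i<r. \<forall>H\<in>As i. x - y i \<in> H"
    using ex_point_agreeing[OF assms(1,3) order_refl] by blast
  have eq: "\<alpha> H x = \<alpha> H (y i)" if "i < r" "H \<in> As i" for i H
  proof -
    have "linear (\<alpha> H)" "\<alpha> H (x - y i) = 0"
      using assms(2) x that sub unfolding defining_forms_def by blast+
    then show ?thesis
      by (simp add: linear_diff)
  qed
  have y_notin: "y i \<notin> \<Union>(As i)" if "i < r" for i
    using chamber_notin_arrangement[OF D y] that by blast
  have x_notin: "x \<notin> \<Union>(As i)" if "i < r" for i
    using y_notin[OF that] eq[OF that]
    unfolding notin_arrangement_iff[OF defining_forms_subset[OF assms(2) sub[OF that]]] by simp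
  moreover have "A = (\<Union>i<r. As i)"
    using assms(3) by (simp add: indecomposable_decomposition_def)
  ultimately obtain C where C: "C \<in> chambers A" "x \<in> C"
    using ex_chamber[of x A] by auto
  moreover have "chamber_proj (As i) C = D i" if i: "i < r" for i
  proof (rule chamber_eqI)
    show forms: "defining_forms \<alpha> (As i)"
      by (rule defining_forms_subset[OF assms(2) sub[OF i]])
    show "chamber_proj (As i) C \<in> chambers (As i)"
      by (rule chamber_proj[OF sub[OF i] C(1)])
    show "D i \<in> chambers (As i)"
      by (rule D[OF i])
    show "eps \<alpha> H 1 (chamber_proj (As i) C) = eps \<alpha> H 1 (D i)" if "H \<in> As i" for H
      using eps_chamber_proj[OF assms(2) sub[OF i] C(1) that]
        eps_chamber[OF assms(2) C(1) _ C(2), of H] eps_chamber[OF forms D[OF i] that y[OF i]]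
        eq[OF i that] sub[OF i] that by auto
  qed
  ultimately show ?thesis
    by blast
qed

section \<open>Restriction and gluing of admissible maps\<close>

lemma map_tuple_in_tuples:
  "C \<in> tuples m X \<Longrightarrow> (\<And>x. x \<in> X \<Longrightarrow> f x \<in> Y) \<Longrightarrow> map_tuple m f C \<in> tuples m Y"
  by (auto simp: map_tuple_def)

lemma map_tuple_comp: "map_tuple m f (map_tuple m g C) = map_tuple m (\<lambda>x. f (g x)) C"
  by (auto simp: map_tuple_def)

lemma map_tuple_cong:
  "C \<in> tuples m X \<Longrightarrow> (\<And>x. x \<in> X \<Longrightarrow> f x = g x) \<Longrightarrow> map_tuple m f C = map_tuple m g C"
  by (auto simp: map_tuple_def intro!: restrict_ext)

lemma map_tuple_id: "C \<in> tuples m X \<Longrightarrow> (\<And>x. x \<in> X \<Longrightarrow> f x = x) \<Longrightarrow> map_tuple m f C = C"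
  by (rule ext) (auto simp: map_tuple_def PiE_def extensional_def Pi_def)

text \<open>An arbitrary section of the projection. The choice does not affect the map induced by an
  admissible map: see \<open>induced_map_chamber_proj\<close>.\<close>

definition chamber_lift :: "(real ^ 'n) set set \<Rightarrow> (real ^ 'n) set set \<Rightarrow> (real ^ 'n) set
    \<Rightarrow> (real ^ 'n) set" where
  "chamber_lift A B D = (SOME C. C \<in> chambers A \<and> chamber_proj B C = D)"

definition induced_map :: "(real ^ 'n) set set \<Rightarrow> (real ^ 'n) set set \<Rightarrow> nat
    \<Rightarrow> ((nat \<Rightarrow> (real ^ 'n) set) \<Rightarrow> (real ^ 'n) set)
    \<Rightarrow> (nat \<Rightarrow> (real ^ 'n) set) \<Rightarrow> (real ^ 'n) set" where
  "induced_map A B m \<Phi> =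
    (\<lambda>D\<in>tuples m (chambers B). chamber_proj B (\<Phi> (map_tuple m (chamber_lift A B) D)))"

lemma chamber_lift:
  fixes A :: "(real ^ 'n) set set"
  assumes "central_arrangement A" "B \<subseteq> A" "D \<in> chambers B"
  shows "chamber_lift A B D \<in> chambers A" "chamber_proj B (chamber_lift A B D) = D"
  using chamber_proj_surj[OF assms] someI_ex[of "\<lambda>C. C \<in> chambers A \<and> chamber_proj B C = D"]
  unfolding chamber_lift_def by blast+

lemma eps_chamber_lift:
  fixes A :: "(real ^ 'n) set set"
  assumes "central_arrangement A" "defining_forms \<alpha> A" "B \<subseteq> A" "D \<in> chambers B" "H \<in> B"
  shows "eps \<alpha> H \<sigma> (chamber_lift A B D) = eps \<alpha> H \<sigma> D"
  using eps_chamber_proj[OF assms(2,3) chamber_lift(1)[OF assms(1,3,4)] assms(5)]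
    chamber_lift(2)[OF assms(1,3,4)] by simp

section \<open>Rules for admissible maps\<close>

lemma admissible_maps_PiE:
  "\<Phi> \<in> admissible_maps \<alpha> A m \<Longrightarrow> \<Phi> \<in> tuples m (chambers A) \<rightarrow>\<^sub>E chambers A"
  unfolding admissible_maps_def by (erule CollectE) (erule conjunct1)

lemma admissible_maps_closed:
  "\<Phi> \<in> admissible_maps \<alpha> A m \<Longrightarrow> C \<in> tuples m (chambers A) \<Longrightarrow> \<Phi> C \<in> chambers A"
  by (rule PiE_mem[OF admissible_maps_PiE])

lemma admissible_mapsE:
  assumes "\<Phi> \<in> admissible_maps \<alpha> A m"
  obtains \<phi> where "\<And>H \<sigma>. H \<in> A \<Longrightarrow> \<phi> H \<sigma> (\<lambda>k\<in>{..<m}. Pos) = Pos"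
    "\<And>H \<sigma> C. H \<in> A \<Longrightarrow> C \<in> tuples m (chambers A) \<Longrightarrow>
      eps \<alpha> H \<sigma> (\<Phi> C) = \<phi> H \<sigma> (map_tuple m (eps \<alpha> H \<sigma>) C)"
proof -
  obtain \<phi> where "\<forall>H\<in>A. \<forall>\<sigma>. \<phi> H \<sigma> (\<lambda>k\<in>{..<m}. Pos) = Pos \<and>
      (\<forall>C\<in>tuples m (chambers A). eps \<alpha> H \<sigma> (\<Phi> C) = \<phi> H \<sigma> (map_tuple m (eps \<alpha> H \<sigma>) C))"
    using assms unfolding admissible_maps_def by (elim CollectE conjE exE)
  then show thesis
    by (intro that[of \<phi>]) simp_all
qed

lemma admissible_mapsI:
  assumes "\<Phi> \<in> tuples m (chambers A) \<rightarrow>\<^sub>E chambers A"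
    and "\<And>H \<sigma>. H \<in> A \<Longrightarrow> \<phi> H \<sigma> (\<lambda>k\<in>{..<m}. Pos) = Pos"
    and "\<And>H \<sigma> C. H \<in> A \<Longrightarrow> C \<in> tuples m (chambers A) \<Longrightarrow>
      eps \<alpha> H \<sigma> (\<Phi> C) = \<phi> H \<sigma> (map_tuple m (eps \<alpha> H \<sigma>) C)"
  shows "\<Phi> \<in> admissible_maps \<alpha> A m"
  unfolding admissible_maps_def
  by (intro CollectI conjI exI[of _ \<phi>] ballI allI) (rule assms; assumption)+

text \<open>Both sides are the value of the same \<phi> at the same sign tuple. This is
  admissibility with the existential \<phi> eliminated.\<close>

lemma admissible_maps_eps_cong:
  assumes "\<Phi> \<in> admissible_maps \<alpha> A m" "H \<in> A"
    and "C \<in> tuples m (chambers A)" "D \<in> tuples m (chambers A)"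
    and "map_tuple m (eps \<alpha> H \<sigma>) C = map_tuple m (eps \<alpha> H \<sigma>) D"
  shows "eps \<alpha> H \<sigma> (\<Phi> C) = eps \<alpha> H \<sigma> (\<Phi> D)"
  using assms(1)
proof (rule admissible_mapsE)
qed (use assms(2-) in simp)

text \<open>The functions \<phi> of \<open>\<Phi>\<close> serve again, because neither lifting nor
  projecting changes a sign at a hyperplane of \<open>B\<close>.\<close>

lemma admissible_induced_map:
  fixes A :: "(real ^ 'n) set set"
  assumes "central_arrangement A" "defining_forms \<alpha> A" "B \<subseteq> A"
    and \<Phi>: "\<Phi> \<in> admissible_maps \<alpha> A m"
  shows "induced_map A B m \<Phi> \<in> admissible_maps \<alpha> B m"
proof (rule admissible_mapsE[OF \<Phi>])
  have lift: "map_tuple m (chamber_lift A B) D \<in> tuples m (chambers A)"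
    if "D \<in> tuples m (chambers B)" for D
    by (rule map_tuple_in_tuples[OF that chamber_lift(1)[OF assms(1,3)]])
  fix \<phi>
  assume \<phi>: "\<And>H \<sigma>. H \<in> A \<Longrightarrow> \<phi> H \<sigma> (\<lambda>k\<in>{..<m}. Pos) = Pos"
    "\<And>H \<sigma> C. H \<in> A \<Longrightarrow> C \<in> tuples m (chambers A) \<Longrightarrow>
      eps \<alpha> H \<sigma> (\<Phi> C) = \<phi> H \<sigma> (map_tuple m (eps \<alpha> H \<sigma>) C)"
  have "eps \<alpha> H \<sigma> (induced_map A B m \<Phi> D) = \<phi> H \<sigma> (map_tuple m (eps \<alpha> H \<sigma>) D)"
    if H: "H \<in> B" and D: "D \<in> tuples m (chambers B)" for H \<sigma> D
  proof -
    have "eps \<alpha> H \<sigma> (induced_map A B m \<Phi> D) = eps \<alpha> H \<sigma> (\<Phi> (map_tuple m (chamber_lift A B) D))"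
      using D eps_chamber_proj[OF assms(2,3) admissible_maps_closed[OF \<Phi> lift[OF D]] H]
      by (simp add: induced_map_def)
    also have "\<dots> = \<phi> H \<sigma> (map_tuple m (\<lambda>D. eps \<alpha> H \<sigma> (chamber_lift A B D)) D)"
      using \<phi>(2)[OF _ lift[OF D], of H \<sigma>] H assms(3) by (auto simp: map_tuple_comp)
    also have "map_tuple m (\<lambda>D. eps \<alpha> H \<sigma> (chamber_lift A B D)) D = map_tuple m (eps \<alpha> H \<sigma>) D"
      by (rule map_tuple_cong[OF D eps_chamber_lift[OF assms(1-3) _ H]])
    finally show ?thesis .
  qed
  moreover have "induced_map A B m \<Phi> \<in> tuples m (chambers B) \<rightarrow>\<^sub>E chambers B"
    unfolding induced_map_def
    using chamber_proj(1)[OF assms(3) admissible_maps_closed[OF \<Phi> lift]] by simp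
  ultimately show ?thesis
    using \<phi>(1) assms(3) by (intro admissible_mapsI[where \<phi> = \<phi>]) auto
qed

text \<open>Independence of the lift: projecting \<open>C\<close> and lifting again may give another
  tuple \<open>?C'\<close>, but it has the same signs as \<open>C\<close> at every hyperplane of
  \<open>B\<close>. By admissibility the values of \<open>\<Phi>\<close> at the two tuples share
  these signs, hence have the same projection.\<close>

lemma induced_map_chamber_proj:
  fixes A :: "(real ^ 'n) set set"
  assumes "central_arrangement A" "defining_forms \<alpha> A" "B \<subseteq> A"
    and \<Phi>: "\<Phi> \<in> admissible_maps \<alpha> A m" and C: "C \<in> tuples m (chambers A)"
  shows "induced_map A B m \<Phi> (map_tuple m (chamber_proj B) C) = chamber_proj B (\<Phi> C)"
proof (rule chamber_eqI)
  have D: "map_tuple m (chamber_proj B) C \<in> tuples m (chambers B)" (is "?D \<in> _")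
    by (rule map_tuple_in_tuples[OF C chamber_proj(1)[OF assms(3)]])
  have C': "map_tuple m (chamber_lift A B) ?D \<in> tuples m (chambers A)" (is "?C' \<in> _")
    by (rule map_tuple_in_tuples[OF D chamber_lift(1)[OF assms(1,3)]])
  show "defining_forms \<alpha> B"
    by (rule defining_forms_subset[OF assms(2,3)])
  show "induced_map A B m \<Phi> ?D \<in> chambers B"
    by (rule admissible_maps_closed[OF admissible_induced_map[OF assms(1-4)] D])
  show "chamber_proj B (\<Phi> C) \<in> chambers B"
    by (rule chamber_proj(1)[OF assms(3) admissible_maps_closed[OF \<Phi> C]])
  fix H assume H: "H \<in> B"
  have "map_tuple m (eps \<alpha> H 1) ?C' =
      map_tuple m (\<lambda>D. eps \<alpha> H 1 (chamber_lift A B D)) ?D"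
    by (simp add: map_tuple_comp)
  also have "\<dots> = map_tuple m (eps \<alpha> H 1) ?D"
    by (rule map_tuple_cong[OF D eps_chamber_lift[OF assms(1-3) _ H]])
  also have "\<dots> = map_tuple m (\<lambda>C. eps \<alpha> H 1 (chamber_proj B C)) C"
    by (simp add: map_tuple_comp)
  also have "\<dots> = map_tuple m (eps \<alpha> H 1) C"
    by (rule map_tuple_cong[OF C eps_chamber_proj[OF assms(2,3) _ H]])
  finally have "eps \<alpha> H 1 (\<Phi> ?C') = eps \<alpha> H 1 (\<Phi> C)"
    using admissible_maps_eps_cong[OF \<Phi> _ C' C] H assms(3) by blast
  then show "eps \<alpha> H 1 (induced_map A B m \<Phi> ?D) = eps \<alpha> H 1 (chamber_proj B (\<Phi> C))"
    using D eps_chamber_proj[OF assms(2,3) admissible_maps_closed[OF \<Phi> C] H]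
      eps_chamber_proj[OF assms(2,3) admissible_maps_closed[OF \<Phi> C'] H]
    by (simp add: induced_map_def)
qed

text \<open>Every hyperplane of \<open>A\<close> belongs to some part, so the projections to the
  parts jointly retain all signs of a chamber. This yields injectivity.\<close>

lemma admissible_map_eqI:
  fixes A :: "(real ^ 'n) set set"
  assumes "defining_forms \<alpha> A" "indecomposable_decomposition A r As"
    and \<Phi>: "\<Phi> \<in> admissible_maps \<alpha> A m" and \<Psi>: "\<Psi> \<in> admissible_maps \<alpha> A m"
    and eq: "\<And>i C. i < r \<Longrightarrow> C \<in> tuples m (chambers A) \<Longrightarrow>
      chamber_proj (As i) (\<Phi> C) = chamber_proj (As i) (\<Psi> C)"
  shows "\<Phi> = \<Psi>"
proof (rule PiE_ext)
  show "\<Phi> \<in> tuples m (chambers A) \<rightarrow>\<^sub>E chambers A" "\<Psi> \<in> tuples m (chambers A) \<rightarrow>\<^sub>E chambers A"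
    by (rule admissible_maps_PiE[OF \<Phi>], rule admissible_maps_PiE[OF \<Psi>])
  fix C assume C: "C \<in> tuples m (chambers A)"
  show "\<Phi> C = \<Psi> C"
  proof (rule chamber_eqI[OF assms(1) admissible_maps_closed[OF \<Phi> C] admissible_maps_closed[OF \<Psi> C]])
    fix H assume "H \<in> A"
    then obtain i where i: "i < r" "H \<in> As i"
      using assms(2) by (auto simp: indecomposable_decomposition_def)
    note e = eps_chamber_proj[OF assms(1) indecomposable_decomposition_subset[OF assms(2) i(1)] _ i(2)]
    show "eps \<alpha> H 1 (\<Phi> C) = eps \<alpha> H 1 (\<Psi> C)"
      using e[OF admissible_maps_closed[OF \<Phi> C]] e[OF admissible_maps_closed[OF \<Psi> C]] eq[OF i(1) C]
      by metis
  qed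
qed

text \<open>The values \<open>G i\<close> at the projected tuples are glued chamber by chamber. At
  \<open>H\<close> the result is admissible through the \<phi> of the part that contains
  \<open>H\<close>, since projection preserves the signs at \<open>H\<close>. This yields
  surjectivity.\<close>

lemma ex_admissible_gluing:
  fixes A :: "(real ^ 'n) set set"
  assumes "central_arrangement A" "defining_forms \<alpha> A" "indecomposable_decomposition A r As"
    and G: "\<And>i. i < r \<Longrightarrow> G i \<in> admissible_maps \<alpha> (As i) m"
  shows "\<exists>\<Phi>\<in>admissible_maps \<alpha> A m. \<forall>i<r. \<forall>C\<in>tuples m (chambers A).
    chamber_proj (As i) (\<Phi> C) = G i (map_tuple m (chamber_proj (As i)) C)"
proof -
  note sub = indecomposable_decomposition_subset[OF assms(3)]
  have proj: "map_tuple m (chamber_proj (As i)) C \<in> tuples m (chambers (As i))"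
    if "i < r" "C \<in> tuples m (chambers A)" for i C
    by (rule map_tuple_in_tuples[OF that(2) chamber_proj(1)[OF sub[OF that(1)]]])
  have "\<exists>E\<in>chambers A. \<forall>i<r. chamber_proj (As i) E = G i (map_tuple m (chamber_proj (As i)) C)"
    if "C \<in> tuples m (chambers A)" for C
    using that by (intro ex_chamber_gluing[OF assms(1-3)] admissible_maps_closed[OF G] proj)
  then obtain \<Phi>' where \<Phi>': "\<And>C. C \<in> tuples m (chambers A) \<Longrightarrow> \<Phi>' C \<in> chambers A"
    "\<And>C i. C \<in> tuples m (chambers A) \<Longrightarrow> i < r \<Longrightarrow>
      chamber_proj (As i) (\<Phi>' C) = G i (map_tuple m (chamber_proj (As i)) C)"
    by metis
  define \<Phi> where "\<Phi> = restrict \<Phi>' (tuples m (chambers A))"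
  \<comment> \<open>The bound on \<open>i\<close> sits inside the existential so that \<phi> can be
    chosen as a function of all \<open>i\<close>.\<close>
  have "\<exists>\<phi>. i < r \<longrightarrow> (\<forall>H\<in>As i. \<forall>\<sigma>. \<phi> H \<sigma> (\<lambda>k\<in>{..<m}. Pos) = Pos \<and>
      (\<forall>C\<in>tuples m (chambers (As i)). eps \<alpha> H \<sigma> (G i C) = \<phi> H \<sigma> (map_tuple m (eps \<alpha> H \<sigma>) C)))"
    for i
  proof (cases "i < r")
    case True
    show ?thesis
    proof (rule admissible_mapsE[OF G[OF True]])
      fix \<phi>
      assume "\<And>H \<sigma>. H \<in> As i \<Longrightarrow> \<phi> H \<sigma> (\<lambda>k\<in>{..<m}. Pos) = Pos"
        "\<And>H \<sigma> C. H \<in> As i \<Longrightarrow> C \<in> tuples m (chambers (As i)) \<Longrightarrow>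
          eps \<alpha> H \<sigma> (G i C) = \<phi> H \<sigma> (map_tuple m (eps \<alpha> H \<sigma>) C)"
      then show ?thesis
        by (intro exI[of _ \<phi>]) simp
    qed
  qed simp
  then obtain \<phi> where \<phi>: "\<And>i H \<sigma>. i < r \<Longrightarrow> H \<in> As i \<Longrightarrow> \<phi> i H \<sigma> (\<lambda>k\<in>{..<m}. Pos) = Pos"
    "\<And>i H \<sigma> C. i < r \<Longrightarrow> H \<in> As i \<Longrightarrow> C \<in> tuples m (chambers (As i)) \<Longrightarrow>
      eps \<alpha> H \<sigma> (G i C) = \<phi> i H \<sigma> (map_tuple m (eps \<alpha> H \<sigma>) C)"
    by metis
  have "\<exists>i<r. H \<in> As i" if "H \<in> A" for H
    using that assms(3) by (auto simp: indecomposable_decomposition_def)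
  \<comment> \<open>\<open>part\<close> assigns to each hyperplane a part containing it, which
    selects the witness used there.\<close>
  then obtain part where part: "\<And>H. H \<in> A \<Longrightarrow> part H < r \<and> H \<in> As (part H)"
    by metis
  have "eps \<alpha> H \<sigma> (\<Phi> C) = \<phi> (part H) H \<sigma> (map_tuple m (eps \<alpha> H \<sigma>) C)"
    if "H \<in> A" and C: "C \<in> tuples m (chambers A)" for H \<sigma> C
  proof -
    have i: "part H < r" "H \<in> As (part H)"
      using part that by auto
    note e = eps_chamber_proj[OF assms(2) sub[OF i(1)] _ i(2)]
    have "eps \<alpha> H \<sigma> (\<Phi> C) = eps \<alpha> H \<sigma> (G (part H) (map_tuple m (chamber_proj (As (part H))) C))"
      using e[OF \<Phi>'(1)[OF C], of \<sigma>] \<Phi>'(2)[OF C i(1)] C by (simp add: \<Phi>_def)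
    also have "\<dots> = \<phi> (part H) H \<sigma>
        (map_tuple m (\<lambda>C. eps \<alpha> H \<sigma> (chamber_proj (As (part H)) C)) C)"
      using \<phi>(2)[OF i proj[OF i(1) C]] by (simp add: map_tuple_comp)
    also have "map_tuple m (\<lambda>C. eps \<alpha> H \<sigma> (chamber_proj (As (part H)) C)) C =
        map_tuple m (eps \<alpha> H \<sigma>) C"
      by (rule map_tuple_cong[OF C e])
    finally show ?thesis .
  qed
  moreover have "\<Phi> \<in> tuples m (chambers A) \<rightarrow>\<^sub>E chambers A"
    using \<Phi>'(1) by (simp add: \<Phi>_def)
  ultimately have "\<Phi> \<in> admissible_maps \<alpha> A m"
    using \<phi>(1) part by (intro admissible_mapsI[where \<phi> = "\<lambda>H. \<phi> (part H) H"]) auto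
  then show ?thesis
    using \<Phi>'(2) by (intro bexI[of _ \<Phi>]) (auto simp: \<Phi>_def)
qed

theorem theorem1p4:
  fixes A :: "(real ^ 'n) set set"
    and \<alpha> :: "(real ^ 'n) set \<Rightarrow> real ^ 'n \<Rightarrow> real"
    and As :: "nat \<Rightarrow> (real ^ 'n) set set"
    and r m :: nat
  assumes "central_arrangement A"
    and "A \<noteq> {}"
    and "defining_forms \<alpha> A"
    and "indecomposable_decomposition A r As"
    and "m > 0"
  shows "\<exists>F. bij_betw F (admissible_maps \<alpha> A m)
               (\<Pi>\<^sub>E i\<in>{..<r}. admissible_maps \<alpha> (As i) m)
           \<and> compatible_with_projections \<alpha> A r As m F"
proof -
  \<comment> \<open>Restricting the index to \<open>{..<r}\<close> places the family of induced maps
    in the extensional product.\<close>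
  define F where "F = (\<lambda>\<Phi>. \<lambda>i\<in>{..<r}. induced_map A (As i) m \<Phi>)"
  note sub = indecomposable_decomposition_subset[OF assms(4)]
  have F_in: "F \<Phi> \<in> (\<Pi>\<^sub>E i\<in>{..<r}. admissible_maps \<alpha> (As i) m)"
    if "\<Phi> \<in> admissible_maps \<alpha> A m" for \<Phi>
    using admissible_induced_map[OF assms(1,3) sub that] by (simp add: F_def)
  have F_proj: "F \<Phi> i (map_tuple m (chamber_proj (As i)) C) = chamber_proj (As i) (\<Phi> C)"
    if "\<Phi> \<in> admissible_maps \<alpha> A m" "i < r" "C \<in> tuples m (chambers A)" for \<Phi> i C
    using induced_map_chamber_proj[OF assms(1,3) sub that(1,3)] that(2) by (simp add: F_def)
  have "inj_on F (admissible_maps \<alpha> A m)"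
  proof (rule inj_onI)
    fix \<Phi> \<Psi> assume \<Phi>: "\<Phi> \<in> admissible_maps \<alpha> A m" and \<Psi>: "\<Psi> \<in> admissible_maps \<alpha> A m"
      and "F \<Phi> = F \<Psi>"
    then show "\<Phi> = \<Psi>"
      by (intro admissible_map_eqI[OF assms(3,4) \<Phi> \<Psi>]) (metis F_proj)
  qed
  moreover have "F ` admissible_maps \<alpha> A m = (\<Pi>\<^sub>E i\<in>{..<r}. admissible_maps \<alpha> (As i) m)"
  proof (intro equalityI subsetI)
    fix G assume G: "G \<in> (\<Pi>\<^sub>E i\<in>{..<r}. admissible_maps \<alpha> (As i) m)"
    have "\<exists>\<Phi>\<in>admissible_maps \<alpha> A m. \<forall>i<r. \<forall>C\<in>tuples m (chambers A).
        chamber_proj (As i) (\<Phi> C) = G i (map_tuple m (chamber_proj (As i)) C)"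
      using PiE_mem[OF G] by (intro ex_admissible_gluing[OF assms(1,3,4)]) simp
    then obtain \<Phi> where \<Phi>: "\<Phi> \<in> admissible_maps \<alpha> A m"
      "\<And>i C. i < r \<Longrightarrow> C \<in> tuples m (chambers A) \<Longrightarrow>
        chamber_proj (As i) (\<Phi> C) = G i (map_tuple m (chamber_proj (As i)) C)"
      by auto
    have "F \<Phi> = G"
    proof (rule PiE_ext[OF F_in[OF \<Phi>(1)] G])
      fix i assume "i \<in> {..<r}"
      then have i: "i < r"
        by simp
      show "F \<Phi> i = G i"
      proof (rule PiE_ext)
        show "F \<Phi> i \<in> tuples m (chambers (As i)) \<rightarrow>\<^sub>E chambers (As i)"
          "G i \<in> tuples m (chambers (As i)) \<rightarrow>\<^sub>E chambers (As i)"
          using PiE_mem[OF F_in[OF \<Phi>(1)], of i] PiE_mem[OF G, of i] i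
          by (simp_all add: admissible_maps_PiE)
        fix D assume D: "D \<in> tuples m (chambers (As i))"
        \<comment> \<open>Every tuple \<open>D\<close> over the part is the projection of its lift
          \<open>?C\<close>. At such a projection both \<open>F \<Phi> i\<close> and
          \<open>G i\<close> equal the projection of \<open>\<Phi> ?C\<close>.\<close>
        let ?C = "map_tuple m (chamber_lift A (As i)) D"
        note lift = chamber_lift[OF assms(1) sub[OF i]]
        have C: "?C \<in> tuples m (chambers A)"
          by (rule map_tuple_in_tuples[OF D lift(1)])
        have "map_tuple m (chamber_proj (As i)) ?C = D"
          unfolding map_tuple_comp by (rule map_tuple_id[OF D lift(2)])
        then show "F \<Phi> i D = G i D"
          using F_proj[OF \<Phi>(1) i C] \<Phi>(2)[OF i C] by simp
      qed
    qed
    then show "G \<in> F ` admissible_maps \<alpha> A m"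
      using \<Phi>(1) by blast
  qed (use F_in in blast)
  ultimately show ?thesis
    unfolding bij_betw_def compatible_with_projections_def using F_proj by (intro exI[of _ F]) simp
qed

end
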